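(* There is a function $\varepsilon(n)$ with $\varepsilon(n)\to 0$ as $n\to\infty$ such that for every $n$ there exists an $n$-vertex graph $G$ with $$m_G(\log n) \le 2^{2^{(\log \log n)^{1/2+\varepsilon(n)}}}.$$
   Context: All logarithms are base $2$. For a graph $G$ and reals $m,r>0$ (not necessarily integers), $G$ is called $(m,r)$-locally Ramsey if every set of at least $m$ vertices of $G$ contains both a clique and an independent set of size at least $r$. $m_G(r)$ denotes the smallest $m$ for which $G$ is $(m,r)$-locally Ramsey, i.e. the smallest $m$ such that any $m$ vertices of $G$ contain both a clique and an independent set of size (at least) $r$. *)

theory Defs
  imports Complex_Main
begin

definition simple_graph :: "'a set \<Rightarrow> ('a \<Rightarrow> 'a \<Rightarrow> bool) \<Rightarrow> bool" where
  "simple_graph V E \<longleftrightarrow> finite V \<and> (\<forall>x y. E x y \<longrightarrow> x \<in> V \<and> y \<in> V)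
     \<and> (\<forall>x y. E x y \<longrightarrow> E y x) \<and> (\<forall>x. \<not> E x x)"

definition is_clique :: "('a \<Rightarrow> 'a \<Rightarrow> bool) \<Rightarrow> 'a set \<Rightarrow> bool" where
  "is_clique E S \<longleftrightarrow> (\<forall>x\<in>S. \<forall>y\<in>S. x \<noteq> y \<longrightarrow> E x y)"

definition is_indep :: "('a \<Rightarrow> 'a \<Rightarrow> bool) \<Rightarrow> 'a set \<Rightarrow> bool" where
  "is_indep E S \<longleftrightarrow> (\<forall>x\<in>S. \<forall>y\<in>S. x \<noteq> y \<longrightarrow> \<not> E x y)"

definition locally_ramsey :: "'a set \<Rightarrow> ('a \<Rightarrow> 'a \<Rightarrow> bool) \<Rightarrow> real \<Rightarrow> real \<Rightarrow> bool" where
  "locally_ramsey V E m r \<longleftrightarrow>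
     (\<forall>S. S \<subseteq> V \<and> real (card S) \<ge> m \<longrightarrow>
        (\<exists>C\<subseteq>S. is_clique E C \<and> real (card C) \<ge> r) \<and>
        (\<exists>I\<subseteq>S. is_indep E I \<and> real (card I) \<ge> r))"

definition mG :: "'a set \<Rightarrow> ('a \<Rightarrow> 'a \<Rightarrow> bool) \<Rightarrow> real \<Rightarrow> nat" where
  "mG V E r = (LEAST m::nat. locally_ramsey V E (real m) r)"

end

theory Submission
  imports Defs "HOL-Library.FuncSet" "HOL-Real_Asymp.Real_Asymp"
begin

text \<open>
  Fix \<open>r \<approx> log n\<close> and alternate two operations. Suppose every set of \<open>m\<close> vertices of a graph contains
  a clique and an independent set of size \<open>r\<close>, and every set of \<open>x = O(r\<^sup>3)\<close> vertices contains an
  edge and a non-edge. In the \<open>k\<close>-th lexicographic power every set of \<open>(2 x)\<^sup>k (2 m)\<^bsup>log r\<^esup>\<close> vertices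
  contains a clique and an independent set of size \<open>r\<close>, but the second property is lost. It is
  restored by recolouring each pair randomly with probability of order \<open>1 / r\<^sup>2\<close>: this destroys large
  homogeneous sets, whereas sets of size \<open>r\<close> have too few pairs to be hit often, so that the
  threshold only grows by a factor polynomial in \<open>r\<close>. With \<open>k = log m\<close>, one round multiplies the
  logarithm of the number of vertices by \<open>log m\<close>, but \<open>log m\<close> only by \<open>O(log r)\<close>. Starting with
  \<open>log m \<approx> 2\<^bsup>w\<^esup>\<close> for \<open>w = \<surd>(log r)\<close>, after \<open>w\<close> rounds there are at least \<open>n\<close> vertices, and \<open>log m\<close>
  is at most \<open>(O(log r))\<^bsup>w\<^esup>\<close>.
\<close>

section \<open>Monochromatic sets and the Ramsey property of vertex sets\<close>

definition monochromatic :: "bool \<Rightarrow> ('a \<Rightarrow> 'a \<Rightarrow> bool) \<Rightarrow> 'a set \<Rightarrow> bool" where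
  "monochromatic c E C \<longleftrightarrow> (\<forall>x\<in>C. \<forall>y\<in>C. x \<noteq> y \<longrightarrow> E x y = c)"

text \<open>The colour \<open>c\<close> lets one argument treat cliques (\<open>True\<close>) and
  independent sets (\<open>False\<close>) together. Asking for exactly \<open>r\<close> vertices
  loses nothing, since monochromatic sets can be shrunk; \<open>r = 2\<close> asks for an edge and a
  non-edge.\<close>

definition ramsey_at :: "'a set \<Rightarrow> ('a \<Rightarrow> 'a \<Rightarrow> bool) \<Rightarrow> nat \<Rightarrow> nat \<Rightarrow> bool" where
  "ramsey_at V E m r \<longleftrightarrow>
     (\<forall>S\<subseteq>V. m \<le> card S \<longrightarrow> (\<forall>c. \<exists>C\<subseteq>S. card C = r \<and> monochromatic c E C))"

lemma monochromatic_subset: "monochromatic c E C \<Longrightarrow> D \<subseteq> C \<Longrightarrow> monochromatic c E D"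
  by (auto simp: monochromatic_def)

lemma ramsey_atD:
  assumes "ramsey_at V E m r" "S \<subseteq> V" "m \<le> card S"
  obtains C where "C \<subseteq> S" "card C = r" "monochromatic c E C"
  using assms unfolding ramsey_at_def by blast

lemma ramsey_at_mono:
  assumes "ramsey_at V E m r" "W \<subseteq> V" "m \<le> m'"
  shows "ramsey_at W E m' r"
  using assms unfolding ramsey_at_def by (meson order_trans)

lemma ramsey_at_vacuous:
  assumes "finite V" "card V < m"
  shows "ramsey_at V E m r"
  using assms unfolding ramsey_at_def by (meson card_mono leD order_trans)

text \<open>Serves to move the property from words, the vertices of a lexicographic power, to an
  initial segment of the naturals.\<close>

lemma ramsey_at_pullback:
  assumes R: "ramsey_at W E m r" and f: "inj_on f V" "f ` V \<subseteq> W"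
  shows "ramsey_at V (\<lambda>u v. E (f u) (f v)) m r"
  unfolding ramsey_at_def
proof (intro allI impI)
  fix S c assume S: "S \<subseteq> V" "m \<le> card S"
  have inj: "inj_on f S" using f(1) S(1) by (rule inj_on_subset)
  have "f ` S \<subseteq> W" "m \<le> card (f ` S)"
    using f(2) S inj by (auto simp: card_image)
  then obtain C where C: "C \<subseteq> f ` S" "card C = r" "monochromatic c E C"
    using R by (rule_tac ramsey_atD)
  then obtain D where D: "D \<subseteq> S" "C = f ` D" by (auto simp: subset_image_iff)
  have "inj_on f D" using inj D(1) by (rule inj_on_subset)
  then have "card D = r" "monochromatic c (\<lambda>u v. E (f u) (f v)) D"
    using C D by (auto simp: card_image monochromatic_def dest: inj_onD)
  with D(1) show "\<exists>C\<subseteq>S. card C = r \<and> monochromatic c (\<lambda>u v. E (f u) (f v)) C" by blast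
qed

section \<open>Lexicographic powers\<close>

text \<open>The default \<open>False\<close> applies only when one word is a prefix of the other,
  hence never to distinct words of equal length.\<close>

fun lexE :: "('a \<Rightarrow> 'a \<Rightarrow> bool) \<Rightarrow> 'a list \<Rightarrow> 'a list \<Rightarrow> bool" where
  "lexE E (a # xs) (b # ys) = (if a = b then lexE E xs ys else E a b)"
| "lexE E _ _ = False"

lemma monochromatic_Cons_image:
  "monochromatic c (lexE E) C \<Longrightarrow> monochromatic c (lexE E) ((#) a ` C)"
  by (auto simp: monochromatic_def)

lemma card_list_children:
  assumes "finite S" "\<And>ys. ys \<in> S \<Longrightarrow> length ys = Suc k"
  shows "card S = (\<Sum>a\<in>hd ` S. card {xs. a # xs \<in> S})"
proof -
  have S: "S = (\<Union>a\<in>hd ` S. (#) a ` {xs. a # xs \<in> S})"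
  proof
    show "S \<subseteq> (\<Union>a\<in>hd ` S. (#) a ` {xs. a # xs \<in> S})"
    proof
      fix ys assume ys: "ys \<in> S"
      with assms(2) obtain a xs where "ys = a # xs" by (metis length_Suc_conv)
      with ys show "ys \<in> (\<Union>a\<in>hd ` S. (#) a ` {xs. a # xs \<in> S})" by force
    qed
  qed auto
  have fin: "finite {xs. a # xs \<in> S}" for a
    by (rule finite_imageD[of "(#) a"]) (auto intro: finite_subset[OF _ assms(1)])
  have "card S = card (\<Union>a\<in>hd ` S. (#) a ` {xs. a # xs \<in> S})" using S by simp
  also have "\<dots> = (\<Sum>a\<in>hd ` S. card ((#) a ` {xs. a # xs \<in> S}))"
    by (rule card_UN_disjoint) (use assms(1) fin in auto)
  also have "\<dots> = (\<Sum>a\<in>hd ` S. card {xs. a # xs \<in> S})"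
    by (intro sum.cong refl card_image) auto
  finally show ?thesis .
qed

text \<open>At every level of the power either \<open>m\<close> children are met, which settles the claim at once; or
  \<open>x\<close> children carry a \<open>1 / (2 m)\<close> fraction of \<open>S\<close> each, and joining two of them doubles the
  target size; or a single child carries a \<open>1 / (2 x)\<close> fraction of \<open>S\<close>.\<close>

lemma lexE_monochromatic:
  assumes R: "ramsey_at V E m r" and X: "ramsey_at V E x 2" and "finite V"
    and pos: "1 \<le> m" "1 \<le> x"
    and "S \<subseteq> {xs. set xs \<subseteq> V \<and> length xs = k}" "(2 * x) ^ k * (2 * m) ^ t \<le> card S"
  shows "\<exists>C\<subseteq>S. min r (2 ^ t) \<le> card C \<and> monochromatic c (lexE E) C"
  using assms(6,7)
proof (induction k arbitrary: t S)
  case 0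
  have "S \<subseteq> {[]}" using "0.prems"(1) by auto
  then have "card S \<le> 1" using card_mono[of "{[]}" S] by simp
  with "0.prems"(2) have "(2 * m) ^ t \<le> 1" by simp
  then have "t = 0" using pos(1) by (cases t) (auto simp: le_Suc_eq)
  with "0.prems"(2) \<open>S \<subseteq> {[]}\<close> show ?case
    by (intro exI[of _ S]) (auto simp: monochromatic_def)
next
  case (Suc k)
  define A where "A a = {xs. a # xs \<in> S}" for a
  define K where "K = hd ` S"
  have finS: "finite S"
    by (rule finite_subset[OF Suc.prems(1) finite_lists_length_eq[OF \<open>finite V\<close>]])
  have "0 < (2 * x) ^ Suc k * (2 * m) ^ t" using pos by simp
  then have Spos: "0 < card S" using Suc.prems(2) by linarith
  have nonempty: "ys \<noteq> []" if "ys \<in> S" for ys using that Suc.prems(1) by auto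
  have KV: "K \<subseteq> V" unfolding K_def
    using Suc.prems(1) nonempty by (force simp: subset_iff)
  have finK: "finite K" using finS by (simp add: K_def)
  have AV: "A a \<subseteq> {xs. set xs \<subseteq> V \<and> length xs = k}" for a
    using Suc.prems(1) by (force simp: A_def)
  have cardS: "card S = (\<Sum>a\<in>K. card (A a))"
    unfolding A_def K_def by (rule card_list_children[OF finS, of k]) (use Suc.prems(1) in auto)
  have lift: "(#) a ` C \<subseteq> S" if "C \<subseteq> A a" for a C using that by (auto simp: A_def)
  consider "t = 0" | t' where "t = Suc t'" "m \<le> card K" | t' where "t = Suc t'" "card K < m"
    by (cases t) force+
  then show ?case
  proof cases
    case 1
    from Spos obtain y where "y \<in> S" by fastforce
    with 1 show ?thesis by (intro exI[of _ "{y}"]) (auto simp: monochromatic_def)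
  next
    case 2
    obtain C where C: "C \<subseteq> K" "card C = r" "monochromatic c E C"
      using ramsey_atD[OF R KV 2(2)] .
    \<comment> \<open>One word per letter suffices: distinct first letters alone decide
      adjacency.\<close>
    have "\<forall>a\<in>K. \<exists>y\<in>S. hd y = a" by (auto simp: K_def)
    then obtain g where g: "\<And>a. a \<in> K \<Longrightarrow> g a \<in> S \<and> hd (g a) = a" by metis
    have "inj_on g C" using g C(1) by (metis inj_onI subsetD)
    then have "card (g ` C) = r" using C(2) by (simp add: card_image)
    moreover have "monochromatic c (lexE E) (g ` C)"
      unfolding monochromatic_def
    proof (intro ballI impI)
      fix y z assume "y \<in> g ` C" "z \<in> g ` C" "y \<noteq> z"
      then obtain a b where ab: "a \<in> C" "b \<in> C" "y = g a" "z = g b" "a \<noteq> b" by auto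
      then have "y = a # tl y" "z = b # tl z"
        using g C(1) nonempty by (metis hd_Cons_tl subsetD)+
      then have "lexE E y z = E a b" using ab(5) by (metis lexE.simps(1))
      then show "lexE E y z = c" using ab C(3) by (auto simp: monochromatic_def)
    qed
    moreover have "g ` C \<subseteq> S" using g C(1) by blast
    ultimately show ?thesis by (intro exI[of _ "g ` C"]) auto
  next
    case 3
    \<comment> \<open>The heavy children. Fewer than \<open>m\<close> light ones, each below a
      \<open>1 / (2 * m)\<close> share, hold at most half of \<open>S\<close>.\<close>
    define B where "B = {a \<in> K. card S \<le> 2 * m * card (A a)}"
    have BK: "B \<subseteq> K" by (auto simp: B_def)
    have finB: "finite B" using BK finK finite_subset by blast
    have "2 * m * (\<Sum>a\<in>K - B. card (A a)) = (\<Sum>a\<in>K - B. 2 * m * card (A a))"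
      by (simp add: sum_distrib_left)
    also have "\<dots> \<le> (\<Sum>a\<in>K - B. card S)" by (intro sum_mono) (auto simp: B_def)
    also have "\<dots> \<le> m * card S"
      using 3(2) card_mono[OF finK, of "K - B"] by simp
    finally have "2 * (\<Sum>a\<in>K - B. card (A a)) \<le> card S" using pos(1) by simp
    moreover have "card S = (\<Sum>a\<in>K - B. card (A a)) + (\<Sum>a\<in>B. card (A a))"
      unfolding cardS by (rule sum.subset_diff[OF BK finK])
    ultimately have big: "card S \<le> 2 * (\<Sum>a\<in>B. card (A a))" by simp
    show ?thesis
    proof (cases "x \<le> card B")
      case True
      obtain C where C: "C \<subseteq> B" "card C = 2" "monochromatic c E C"
        using ramsey_atD[OF X _ True] BK KV by blast
      then obtain a b where ab: "C = {a, b}" "a \<noteq> b" by (auto simp: card_2_iff)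
      \<comment> \<open>Passing to a heavy child costs the factor \<open>2 * m\<close> released by
        lowering \<open>t\<close> to \<open>t'\<close>; the power of \<open>2 * x\<close> only has
        slack here.\<close>
      have "\<exists>D\<subseteq>A d. min r (2 ^ t') \<le> card D \<and> monochromatic c (lexE E) D" if "d \<in> B" for d
      proof (rule Suc.IH[OF AV])
        have "2 * m * ((2 * x) ^ Suc k * (2 * m) ^ t') \<le> card S"
          using Suc.prems(2) 3(1) by (simp add: mult_ac)
        also have "\<dots> \<le> 2 * m * card (A d)" using that by (simp add: B_def)
        finally have *: "(2 * x) ^ Suc k * (2 * m) ^ t' \<le> card (A d)"
          using pos(1) by (simp only: mult_le_cancel1)
        have "(2 * x) ^ k * (2 * m) ^ t' \<le> (2 * x) ^ Suc k * (2 * m) ^ t'"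
          using pos(2) by (intro mult_right_mono power_increasing) auto
        with * show "(2 * x) ^ k * (2 * m) ^ t' \<le> card (A d)" by linarith
      qed
      then obtain D where D: "\<And>d. d \<in> B \<Longrightarrow> D d \<subseteq> A d \<and> min r (2 ^ t') \<le> card (D d)
          \<and> monochromatic c (lexE E) (D d)" by metis
      have abB: "a \<in> B" "b \<in> B" using C(1) ab(1) by auto
      let ?C = "(#) a ` D a \<union> (#) b ` D b"
      have sub: "?C \<subseteq> S" using lift D abB by (metis Un_least)
      have "card ?C = card ((#) a ` D a) + card ((#) b ` D b)"
        using sub finS ab(2) by (intro card_Un_disjoint) (auto intro: finite_subset)
      also have "\<dots> = card (D a) + card (D b)" by (simp add: card_image)
      finally have "min r (2 ^ t) \<le> card ?C"
        using D[OF abB(1)] D[OF abB(2)] 3(1) by auto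
      moreover have "monochromatic c (lexE E) ?C"
        using monochromatic_Cons_image D abB C(3) ab unfolding monochromatic_def by fastforce
      ultimately show ?thesis using sub by blast
    next
      case False
      \<comment> \<open>Fewer than \<open>x\<close> heavy children hold at least half of
        \<open>S\<close>, so one has a \<open>1 / (2 * x)\<close> share. This costs one factor
        \<open>2 * x\<close> and keeps \<open>t\<close>.\<close>
      have "\<exists>a\<in>B. card S \<le> 2 * x * card (A a)"
      proof (rule ccontr)
        assume "\<not> ?thesis"
        then have "(\<Sum>a\<in>B. 2 * x * card (A a)) \<le> (\<Sum>a\<in>B. card S)" by (intro sum_mono) auto
        moreover have "(\<Sum>a\<in>B. 2 * x * card (A a)) = x * (2 * (\<Sum>a\<in>B. card (A a)))"
          by (simp add: sum_distrib_left mult_ac)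
        moreover have "(\<Sum>a\<in>B. card S) < x * card S" using False Spos by simp
        moreover have "x * card S \<le> x * (2 * (\<Sum>a\<in>B. card (A a)))" using big by simp
        ultimately show False by linarith
      qed
      then obtain a where a: "a \<in> B" "card S \<le> 2 * x * card (A a)" by blast
      have "2 * x * ((2 * x) ^ k * (2 * m) ^ t) \<le> 2 * x * card (A a)"
        using order_trans[OF Suc.prems(2) a(2)] by (simp only: power_Suc mult.assoc)
      then have "(2 * x) ^ k * (2 * m) ^ t \<le> card (A a)"
        using pos(2) by (simp only: mult_le_cancel1)
      then obtain D where "D \<subseteq> A a" "min r (2 ^ t) \<le> card D" "monochromatic c (lexE E) D"
        using Suc.IH[OF AV] by blast
      then show ?thesis
        using lift monochromatic_Cons_image by (intro exI[of _ "(#) a ` D"]) (auto simp: card_image)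
    qed
  qed
qed

text \<open>\<open>t\<close> doublings suffice to reach \<open>r\<close>; any surplus is
  trimmed.\<close>

lemma ramsey_at_lexE:
  assumes "ramsey_at V E m r" "ramsey_at V E x 2" "finite V" "1 \<le> m" "1 \<le> x" "r \<le> 2 ^ t"
  shows "ramsey_at {xs. set xs \<subseteq> V \<and> length xs = k} (lexE E) ((2 * x) ^ k * (2 * m) ^ t) r"
  unfolding ramsey_at_def
proof (intro allI impI)
  fix S c assume "S \<subseteq> {xs. set xs \<subseteq> V \<and> length xs = k}" "(2 * x) ^ k * (2 * m) ^ t \<le> card S"
  from lexE_monochromatic[OF assms(1-5) this]
  obtain C where C: "C \<subseteq> S" "r \<le> card C" "monochromatic c (lexE E) C"
    using assms(6) by (metis min_absorb1)
  then obtain D where "D \<subseteq> C" "card D = r" by (metis obtain_subset_with_card_n)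
  moreover have "D \<subseteq> S" "monochromatic c (lexE E) D"
    using C calculation monochromatic_subset by blast+
  ultimately show "\<exists>C\<subseteq>S. card C = r \<and> monochromatic c (lexE E) C" by blast
qed

section \<open>Random recolouring\<close>

text \<open>Ordering the endpoints represents each unordered pair once, so a function on
  \<open>pairs\<close> assigns one value to each potential edge.\<close>

definition pairs :: "nat set \<Rightarrow> (nat \<times> nat) set" where
  "pairs C = {(u, v). u \<in> C \<and> v \<in> C \<and> u < v}"

lemma pairs_subset: "pairs C \<subseteq> C \<times> C"
  by (auto simp: pairs_def)

lemma finite_pairs: "finite C \<Longrightarrow> finite (pairs C)"
  using finite_subset[OF pairs_subset] by simp

lemma pairs_mono: "C \<subseteq> D \<Longrightarrow> pairs C \<subseteq> pairs D"
  by (auto simp: pairs_def)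

lemma card_pairs_le: "finite C \<Longrightarrow> card (pairs C) \<le> card C ^ 2"
  using card_mono[OF _ pairs_subset, of C] by (simp add: card_cartesian_product power2_eq_square)

lemma card_pairs:
  assumes "finite C"
  shows "2 * card (pairs C) + card C = card C ^ 2"
proof -
  have "card C ^ 2 = card (C \<times> C)" by (simp add: card_cartesian_product power2_eq_square)
  also have "C \<times> C = (pairs C \<union> prod.swap ` pairs C) \<union> (\<lambda>u. (u, u)) ` C"
    by (auto simp: pairs_def)
  also have "card \<dots> = card (pairs C \<union> prod.swap ` pairs C) + card ((\<lambda>u. (u, u)) ` C)"
    using assms finite_pairs[OF assms] by (intro card_Un_disjoint) (auto simp: pairs_def)
  also have "card (pairs C \<union> prod.swap ` pairs C) = card (pairs C) + card (prod.swap ` pairs C)"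
    using assms finite_pairs[OF assms] by (intro card_Un_disjoint) (auto simp: pairs_def)
  also have "card (prod.swap ` pairs C) = card (pairs C)" by (rule card_image) simp
  also have "card ((\<lambda>u. (u, u)) ` C) = card C" by (rule card_image) (simp add: inj_on_def)
  finally show ?thesis by simp
qed

section \<open>Large families of edge-disjoint sets\<close>

text \<open>Greedy choice: take a vertex, discard it with its at most \<open>k\<close> neighbours,
  and continue.\<close>

lemma independent_set_of_bounded_degree:
  assumes "finite W" "symp R" "\<And>v. v \<in> W \<Longrightarrow> card {u \<in> W. R v u} \<le> k"
  shows "\<exists>I\<subseteq>W. (\<forall>u\<in>I. \<forall>v\<in>I. u \<noteq> v \<longrightarrow> \<not> R u v) \<and> card W \<le> (k + 1) * card I"
  using assms(1,3)
proof (induction W rule: finite_psubset_induct)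
  case (psubset W)
  show ?case
  proof (cases "W = {}")
    case False
    then obtain v where v: "v \<in> W" by blast
    define N where "N = insert v {u \<in> W. R v u}"
    have N: "N \<subseteq> W" "finite N" using v psubset.hyps(1) by (auto simp: N_def)
    have "card N \<le> Suc (card {u \<in> W. R v u})" unfolding N_def by (rule card_insert_le_m1) auto
    then have cN: "card N \<le> k + 1" using psubset.prems[OF v] by simp
    have less: "W - N \<subset> W" using v by (auto simp: N_def)
    have "card {u \<in> W - N. R w u} \<le> k" if "w \<in> W - N" for w
    proof -
      have "card {u \<in> W - N. R w u} \<le> card {u \<in> W. R w u}"
        using psubset.hyps(1) by (intro card_mono) auto
      also have "\<dots> \<le> k" using psubset.prems that by blast
      finally show ?thesis .
    qed
    from psubset.IH[OF less this] obtain I where I: "I \<subseteq> W - N" "\<forall>u\<in>I. \<forall>v\<in>I. u \<noteq> v \<longrightarrow> \<not> R u v"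
      "card (W - N) \<le> (k + 1) * card I" by blast
    have vI: "v \<notin> I" "finite I"
      using I(1) psubset.hyps(1) by (auto simp: N_def intro: finite_subset)
    have "card W = card N + card (W - N)"
      using N psubset.hyps(1) by (metis card_Diff_subset card_mono le_add_diff_inverse)
    also have "\<dots> \<le> (k + 1) * card (insert v I)" using cN I(3) vI by simp
    finally have "card W \<le> (k + 1) * card (insert v I)" .
    moreover have "\<forall>u\<in>insert v I. \<forall>w\<in>insert v I. u \<noteq> w \<longrightarrow> \<not> R u w"
    proof (intro ballI impI)
      have no: "\<not> R v w" if "w \<in> I" for w using that I(1) by (auto simp: N_def)
      fix u w assume "u \<in> insert v I" "w \<in> insert v I" "u \<noteq> w"
      then show "\<not> R u w" using no I(2) sympD[OF assms(2)] by blast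
    qed
    moreover have "insert v I \<subseteq> W" using v I(1) by blast
    ultimately show ?thesis by blast
  qed auto
qed

text \<open>Sets are added one at a time. Those chosen so far cover an average vertex at most
  \<open>r * (r + 3)\<close> times, so half of \<open>S\<close> is covered at most twice as often.
  Among these vertices there are \<open>m\<close>, no two of which share a chosen set; an
  \<open>r\<close>-set inside them repeats no pair.\<close>

lemma edge_disjoint_family:
  fixes S :: "nat set"
  assumes "finite S" "2 \<le> r" and large: "2 * m * (2 * r\<^sup>2 * (r + 3) + 1) \<le> card S"
    and Q: "\<And>T. T \<subseteq> S \<Longrightarrow> m \<le> card T \<Longrightarrow> \<exists>C\<subseteq>T. card C = r \<and> Q C"
    and "f \<le> card S * (r + 3)"
  shows "\<exists>F. finite F \<and> card F = f \<and> (\<forall>C\<in>F. C \<subseteq> S \<and> card C = r \<and> Q C)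
    \<and> (\<forall>C\<in>F. \<forall>D\<in>F. C \<noteq> D \<longrightarrow> pairs C \<inter> pairs D = {})"
  using assms(5)
proof (induction f)
  case 0
  then show ?case by (intro exI[of _ "{}"]) auto
next
  case (Suc f)
  then obtain F where F: "finite F" "card F = f" "\<And>C. C \<in> F \<Longrightarrow> C \<subseteq> S \<and> card C = r \<and> Q C"
    "\<forall>C\<in>F. \<forall>D\<in>F. C \<noteq> D \<longrightarrow> pairs C \<inter> pairs D = {}" by auto
  define deg where "deg v = card {C \<in> F. v \<in> C}" for v
  define d where "d = r * (r + 3)"
  have dpos: "0 < d" using assms(2) by (simp add: d_def)
  have "(\<Sum>v\<in>S. deg v) = (\<Sum>v\<in>S. \<Sum>C\<in>F. if v \<in> C then 1 else 0)"
    using F(1) by (simp add: deg_def flip: sum.inter_filter)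
  also have "\<dots> = (\<Sum>C\<in>F. \<Sum>v\<in>S. if v \<in> C then 1 else 0)" by (rule sum.swap)
  also have "\<dots> = (\<Sum>C\<in>F. r)"
  proof (rule sum.cong[OF refl])
    fix C assume "C \<in> F"
    then have "{v \<in> S. v \<in> C} = C" "card C = r" using F(3) by auto
    then show "(\<Sum>v\<in>S. if v \<in> C then 1 else 0) = r"
      using assms(1) by (simp flip: sum.inter_filter)
  qed
  also have "\<dots> \<le> card S * d" using Suc.prems F(2) by (simp add: d_def mult.commute mult.left_commute)
  finally have degsum: "(\<Sum>v\<in>S. deg v) \<le> card S * d" .
  define W where "W = {v \<in> S. deg v \<le> 2 * d}"
  have W: "W \<subseteq> S" "finite W" using assms(1) by (auto simp: W_def)
  \<comment> \<open>Markov's inequality: at most half of the vertices exceed twice the bound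
    \<open>d\<close> on the average degree.\<close>
  have "card (S - W) * (2 * d) = (\<Sum>v\<in>S - W. 2 * d)" by simp
  also have "\<dots> \<le> (\<Sum>v\<in>S - W. deg v)" by (intro sum_mono) (auto simp: W_def)
  also have "\<dots> \<le> (\<Sum>v\<in>S. deg v)" using assms(1) by (intro sum_mono2) auto
  also note degsum
  finally have "2 * card (S - W) \<le> card S" using dpos by simp
  moreover have "card S = card W + card (S - W)"
    using W assms(1) by (metis card_Diff_subset card_mono le_add_diff_inverse)
  ultimately have cW: "card S \<le> 2 * card W" by simp
  define R where "R u v \<longleftrightarrow> (\<exists>C\<in>F. u \<in> C \<and> v \<in> C)" for u v
  have "symp R" unfolding R_def by (rule sympI) blast
  have "card {u \<in> W. R v u} \<le> 2 * r\<^sup>2 * (r + 3)" if "v \<in> W" for v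
  proof -
    have finC: "finite C" if "C \<in> F" for C using F(3)[OF that] assms(1) finite_subset by blast
    have "card {u \<in> W. R v u} \<le> card (\<Union>{C \<in> F. v \<in> C})"
      using F(1) finC by (intro card_mono) (auto simp: R_def)
    also have "\<dots> \<le> (\<Sum>C\<in>{C \<in> F. v \<in> C}. card C)"
      by (rule card_Union_le_sum_card)
    also have "\<dots> = deg v * r" using F(3) by (simp add: deg_def)
    also have "\<dots> \<le> 2 * d * r" using that by (simp add: W_def)
    finally show ?thesis by (simp add: d_def power2_eq_square mult_ac)
  qed
  from independent_set_of_bounded_degree[OF W(2) \<open>symp R\<close> this]
  obtain I where I: "I \<subseteq> W" "\<forall>u\<in>I. \<forall>v\<in>I. u \<noteq> v \<longrightarrow> \<not> R u v"
    "card W \<le> (2 * r\<^sup>2 * (r + 3) + 1) * card I" by blast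
  define e where "e = 2 * r\<^sup>2 * (r + 3) + 1"
  have "e * (2 * m) \<le> card S" using large unfolding e_def by (simp only: mult.commute)
  also have "\<dots> \<le> e * (2 * card I)" using cW I(3) unfolding e_def[symmetric] by simp
  finally have "m \<le> card I" using e_def by (simp only: mult_le_cancel1 zero_less_Suc Suc_eq_plus1[symmetric] simp_thms)
  then obtain C where C: "C \<subseteq> I" "card C = r" "Q C" using Q I(1) W(1) by (meson order_trans)
  have disj: "pairs C \<inter> pairs D = {}" if "D \<in> F" for D
  proof (rule equals0I)
    fix p assume "p \<in> pairs C \<inter> pairs D"
    then obtain u v where "u \<in> C" "v \<in> C" "u \<in> D" "v \<in> D" "u \<noteq> v" by (auto simp: pairs_def)
    with that I(2) C(1) show False unfolding R_def by blast
  qed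
  \<comment> \<open>As \<open>C\<close> is pair-disjoint from every member of \<open>F\<close>,
    spanning at least one pair shows that it is a new member.\<close>
  have "pairs C \<noteq> {}"
  proof -
    have "finite C" using C(2) assms(2) by (intro card_ge_0_finite) simp
    then have "2 * card (pairs C) + r = r * r" using card_pairs[of C] C(2) by (simp add: power2_eq_square)
    moreover have "r * r \<ge> 2 * r" using assms(2) by simp
    ultimately show ?thesis using assms(2) by auto
  qed
  with disj have "C \<notin> F" by blast
  then have "card (insert C F) = Suc f" using F(1,2) by simp
  moreover have "\<forall>D\<in>insert C F. D \<subseteq> S \<and> card D = r \<and> Q D"
    using F(3) C I(1) W(1) by blast
  moreover have "\<forall>D\<in>insert C F. \<forall>D'\<in>insert C F. D \<noteq> D' \<longrightarrow> pairs D \<inter> pairs D' = {}"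
    using F(4) disj by (metis Int_commute insert_iff)
  ultimately show ?case using F(1) by (meson finite.insertI)
qed

section \<open>Counting random assignments of values to pairs\<close>

text \<open>A given \<open>P C\<close> is hit with probability at most
  \<open>d * (2 / (4 * d)) = 1 / 2\<close>, independently over disjoint sets. The count runs over
  choices \<open>g\<close> of one hit position in each set: there are at most
  \<open>d ^ card F\<close>, and disjointness makes each \<open>g\<close> injective.\<close>

lemma card_functions_hitting:
  fixes P :: "'c \<Rightarrow> 'i set"
  assumes "finite I" "finite F" "1 \<le> d"
    and P: "\<And>C. C \<in> F \<Longrightarrow> P C \<subseteq> I \<and> card (P C) \<le> d"
    and disj: "\<And>C D. C \<in> F \<Longrightarrow> D \<in> F \<Longrightarrow> C \<noteq> D \<Longrightarrow> P C \<inter> P D = {}"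
  shows "card {\<xi> \<in> I \<rightarrow>\<^sub>E {..<4 * d}. \<forall>C\<in>F. \<exists>i\<in>P C. \<xi> i < 2} * 2 ^ card F \<le> (4 * d) ^ card I"
proof -
  let ?\<Omega> = "I \<rightarrow>\<^sub>E {..<4 * d}"
  let ?H = "\<lambda>g. {\<xi> \<in> ?\<Omega>. \<forall>C\<in>F. \<xi> (g C) < 2}"
  have finP: "finite (P C)" if "C \<in> F" for C using P[OF that] assms(1) finite_subset by blast
  have finG: "finite (PiE F P)" using assms(2) finP by (rule finite_PiE)
  have sub: "{\<xi> \<in> ?\<Omega>. \<forall>C\<in>F. \<exists>i\<in>P C. \<xi> i < 2} \<subseteq> (\<Union>g\<in>PiE F P. ?H g)"
  proof
    fix \<xi> assume "\<xi> \<in> {\<xi> \<in> ?\<Omega>. \<forall>C\<in>F. \<exists>i\<in>P C. \<xi> i < 2}"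
    then have \<xi>: "\<xi> \<in> ?\<Omega>" "\<forall>C\<in>F. \<exists>i. i \<in> P C \<and> \<xi> i < 2" by auto
    then obtain g where g: "\<forall>C\<in>F. g C \<in> P C \<and> \<xi> (g C) < 2" by metis
    then have "restrict g F \<in> PiE F P" "\<xi> \<in> ?H (restrict g F)" using \<xi>(1) by auto
    then show "\<xi> \<in> (\<Union>g\<in>PiE F P. ?H g)" by blast
  qed
  have H: "card (?H g) * (2 * d) ^ card F \<le> (4 * d) ^ card I" if g: "g \<in> PiE F P" for g
  proof -
    have inj: "inj_on g F"
      using g disj by (intro inj_onI) (metis IntI PiE_mem empty_iff)
    have gI: "g ` F \<subseteq> I" using g P by (auto dest: PiE_mem)
    have "?H g = PiE I (\<lambda>i. if i \<in> g ` F then {..<2} else {..<4 * d})"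
    proof (rule set_eqI)
      fix \<xi>
      have "\<xi> (g C) < 4 * d" if "\<xi> (g C) < 2" for C using that assms(3) by linarith
      then show "\<xi> \<in> ?H g \<longleftrightarrow> \<xi> \<in> PiE I (\<lambda>i. if i \<in> g ` F then {..<2} else {..<4 * d})"
        using gI by (auto simp: PiE_iff extensional_def split: if_splits)
    qed
    then have "card (?H g) = (\<Prod>i\<in>I. card (if i \<in> g ` F then {..<2::nat} else {..<4 * d}))"
      using assms(1) by (simp add: card_PiE)
    also have "\<dots> = (\<Prod>i\<in>I - g ` F. card (if i \<in> g ` F then {..<2::nat} else {..<4 * d}))
        * (\<Prod>i\<in>g ` F. card (if i \<in> g ` F then {..<2::nat} else {..<4 * d}))"
      using gI assms(1) by (rule prod.subset_diff)
    also have "\<dots> = (4 * d) ^ (card I - card F) * 2 ^ card F"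
      using inj gI assms(1,2) by (simp add: card_Diff_subset finite_subset card_image)
    finally have "card (?H g) = (4 * d) ^ (card I - card F) * 2 ^ card F" .
    moreover have "2 ^ card F * (2 * d) ^ card F = (4 * d) ^ card F"
      by (subst power_mult_distrib[symmetric]) simp
    ultimately have "card (?H g) * (2 * d) ^ card F = (4 * d) ^ (card I - card F) * (4 * d) ^ card F"
      by (simp only: mult.assoc)
    also have "\<dots> = (4 * d) ^ card I"
      using card_mono[OF assms(1) gI] unfolding card_image[OF inj]
      by (simp only: power_add[symmetric] le_add_diff_inverse2)
    finally show ?thesis by simp
  qed
  have finH: "finite (?H g)" for g
    by (rule finite_subset[OF _ finite_PiE[OF assms(1), of "\<lambda>_. {..<4 * d}"]]) auto
  have "card {\<xi> \<in> ?\<Omega>. \<forall>C\<in>F. \<exists>i\<in>P C. \<xi> i < 2} \<le> card (\<Union>g\<in>PiE F P. ?H g)"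
    using finG finH by (intro card_mono sub finite_UN_I)
  also have "\<dots> \<le> (\<Sum>g\<in>PiE F P. card (?H g))" by (rule card_UN_le[OF finG])
  finally have "card {\<xi> \<in> ?\<Omega>. \<forall>C\<in>F. \<exists>i\<in>P C. \<xi> i < 2} \<le> (\<Sum>g\<in>PiE F P. card (?H g))" .
  then have "card {\<xi> \<in> ?\<Omega>. \<forall>C\<in>F. \<exists>i\<in>P C. \<xi> i < 2} * (2 * d) ^ card F
      \<le> (\<Sum>g\<in>PiE F P. card (?H g) * (2 * d) ^ card F)"
    unfolding sum_distrib_right[symmetric] by (rule mult_le_mono1)
  also have "\<dots> \<le> (\<Sum>g\<in>PiE F P. (4 * d) ^ card I)" using H by (rule sum_mono)
  also have "\<dots> = card (PiE F P) * (4 * d) ^ card I" by simp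
  also have "\<dots> \<le> d ^ card F * (4 * d) ^ card I"
  proof -
    have "card (PiE F P) = (\<Prod>C\<in>F. card (P C))" using assms(2) by (rule card_PiE)
    also have "\<dots> \<le> (\<Prod>C\<in>F. d)" using P by (intro prod_mono) auto
    finally show ?thesis by simp
  qed
  finally have "d ^ card F * (card {\<xi> \<in> ?\<Omega>. \<forall>C\<in>F. \<exists>i\<in>P C. \<xi> i < 2} * 2 ^ card F)
      \<le> d ^ card F * (4 * d) ^ card I"
    unfolding power_mult_distrib[of 2 d] by (simp only: mult.assoc mult.commute mult.left_commute)
  moreover have "0 < d ^ card F" using assms(3) by simp
  ultimately show ?thesis by (simp only: mult_le_cancel1)
qed

text \<open>\<open>(1 - 1 / D) ^ D\<close> is at most \<open>1 / 2\<close>, by Bernoulli's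
  inequality for the inverse \<open>1 + 1 / (D - 1)\<close>; this needs
  \<open>D > 1\<close>.\<close>

lemma pred_power_mult_two_power_le:
  assumes "D * q \<le> p" "1 \<le> (D :: nat)"
  shows "(D - 1) ^ p * 2 ^ q \<le> D ^ p"
proof (cases "D = 1")
  case True
  with assms show ?thesis by (cases p) auto
next
  case False
  then have D: "2 \<le> D" using assms(2) by simp
  have "2 \<le> 1 + real D * (1 / real (D - 1))" using D by (simp add: field_simps)
  also have "\<dots> \<le> (1 + 1 / real (D - 1)) ^ D"
    by (rule Bernoulli_inequality) (rule order_trans[of _ 0], auto)
  also have "1 + 1 / real (D - 1) = real D / real (D - 1)" using D by (simp add: field_simps)
  finally have "2 * real (D - 1) ^ D \<le> real D ^ D" using D by (simp add: power_divide field_simps)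
  then have "real (2 * (D - 1) ^ D) \<le> real (D ^ D)" by simp
  then have "2 * (D - 1) ^ D \<le> D ^ D" by (simp only: of_nat_le_iff)
  then have "(2 * (D - 1) ^ D) ^ q \<le> (D ^ D) ^ q" by (rule power_mono) simp
  then have 1: "(D - 1) ^ (D * q) * 2 ^ q \<le> D ^ (D * q)"
    by (simp add: power_mult power_mult_distrib mult.commute)
  have "(D - 1) ^ p * 2 ^ q = ((D - 1) ^ (D * q) * 2 ^ q) * (D - 1) ^ (p - D * q)"
    using assms(1) by (simp add: mult_ac flip: power_add)
  also have "\<dots> \<le> D ^ (D * q) * D ^ (p - D * q)"
    using 1 by (intro mult_mono power_mono) auto
  also have "\<dots> = D ^ p" using assms(1) by (simp flip: power_add)
  finally show ?thesis .
qed

text \<open>Each entry in \<open>Y\<close> misses \<open>j\<close> with probability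
  \<open>1 - 1 / D\<close>, so every \<open>D\<close> independent entries contribute a factor of at
  most one half.\<close>

lemma card_functions_avoiding:
  assumes "finite I" "Y \<subseteq> I" "j < D" "D * q \<le> card Y"
  shows "card {\<xi> \<in> I \<rightarrow>\<^sub>E {..<D}. \<forall>i\<in>Y. \<xi> i \<noteq> j} * 2 ^ q \<le> (D :: nat) ^ card I"
proof -
  have finY: "finite Y" using assms finite_subset by blast
  have "{\<xi> \<in> I \<rightarrow>\<^sub>E {..<D}. \<forall>i\<in>Y. \<xi> i \<noteq> j} = PiE I (\<lambda>i. if i \<in> Y then {..<D} - {j} else {..<D})"
    using assms(2) by (auto simp: PiE_iff extensional_def split: if_splits)
  then have "card {\<xi> \<in> I \<rightarrow>\<^sub>E {..<D}. \<forall>i\<in>Y. \<xi> i \<noteq> j}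
      = (\<Prod>i\<in>I. card (if i \<in> Y then {..<D} - {j} else {..<D}))"
    using assms(1) by (simp add: card_PiE)
  also have "\<dots> = (\<Prod>i\<in>I - Y. card (if i \<in> Y then {..<D} - {j} else {..<D}))
      * (\<Prod>i\<in>Y. card (if i \<in> Y then {..<D} - {j} else {..<D}))"
    using assms(2,1) by (rule prod.subset_diff)
  also have "\<dots> = D ^ (card I - card Y) * (D - 1) ^ card Y"
    using assms finY by (simp add: card_Diff_subset)
  finally have "card {\<xi> \<in> I \<rightarrow>\<^sub>E {..<D}. \<forall>i\<in>Y. \<xi> i \<noteq> j} * 2 ^ q
      = D ^ (card I - card Y) * ((D - 1) ^ card Y * 2 ^ q)" by simp
  also have "\<dots> \<le> D ^ (card I - card Y) * D ^ card Y"
    using pred_power_mult_two_power_le[OF assms(4)] assms(3) by simp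
  also have "\<dots> = D ^ card I" using card_mono[OF assms(1,2)] by (simp flip: power_add)
  finally show ?thesis .
qed

text \<open>A union bound over at most \<open>N ^ s \<le> 2 ^ (s * r)\<close> sets and two colours.
  The extra 3 in the exponent leaves a total share of one quarter.\<close>

lemma card_union_over_subsets:
  fixes B :: "nat set \<Rightarrow> bool \<Rightarrow> 'b set"
  assumes "N \<le> 2 ^ r"
    and B: "\<And>S c. S \<subseteq> {..<N} \<Longrightarrow> card S = s \<Longrightarrow> card (B S c) * 2 ^ (s * r + 3) \<le> w"
  shows "4 * card (\<Union>S\<in>{S. S \<subseteq> {..<N} \<and> card S = s}. \<Union>c. B S c) \<le> w"
proof -
  let ?U = "{S. S \<subseteq> {..<N} \<and> card S = s}"
  have finU: "finite ?U" by (rule finite_subset[of _ "Pow {..<N}"]) auto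
  have cU: "card ?U \<le> 2 ^ (s * r)"
  proof (cases "s \<le> N")
    case True
    have "card ?U = N choose s" using n_subsets[of "{..<N}" s] by simp
    also have "\<dots> \<le> N ^ s" using True by (rule binomial_le_pow)
    also have "\<dots> \<le> (2 ^ r) ^ s" using assms(1) by (rule power_mono) simp
    finally show ?thesis by (simp add: power_mult mult.commute flip: power_mult)
  next
    case False
    have "card ?U = N choose s" using n_subsets[of "{..<N}" s] by simp
    also have "\<dots> = 0" using False by (simp add: binomial_eq_0)
    finally show ?thesis by (simp only: le0)
  qed
  have two: "card (\<Union>c. B S c) * 2 ^ (s * r + 2) \<le> w" if "S \<in> ?U" for S
  proof -
    have "card (\<Union>c. B S c) \<le> (\<Sum>c\<in>UNIV. card (B S c))" by (rule card_UN_le) simp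
    then have "card (\<Union>c. B S c) * 2 ^ (s * r + 2) \<le> (\<Sum>c\<in>UNIV. card (B S c)) * 2 ^ (s * r + 2)"
      by simp
    also have "\<dots> = card (B S True) * 2 ^ (s * r + 2) + card (B S False) * 2 ^ (s * r + 2)"
      by (simp add: UNIV_bool algebra_simps)
    finally show ?thesis using B[of S True] B[of S False] that by (simp add: power_add)
  qed
  have "2 ^ (s * r) * (4 * card (\<Union>S\<in>?U. \<Union>c. B S c)) = card (\<Union>S\<in>?U. \<Union>c. B S c) * 2 ^ (s * r + 2)"
    by (simp add: power_add)
  also have "\<dots> \<le> (\<Sum>S\<in>?U. card (\<Union>c. B S c)) * 2 ^ (s * r + 2)"
    by (intro mult_right_mono card_UN_le finU) simp
  also have "\<dots> = (\<Sum>S\<in>?U. card (\<Union>c. B S c) * 2 ^ (s * r + 2))" by (rule sum_distrib_right)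
  also have "\<dots> \<le> (\<Sum>S\<in>?U. w)" using two by (rule sum_mono)
  also have "\<dots> \<le> 2 ^ (s * r) * w" using cU by simp
  finally show ?thesis by simp
qed

text \<open>With \<open>D = 4 r\<^sup>2\<close>, each pair is independently forced to be an edge or a non-edge with probability
  \<open>1 / D\<close> each. A given set of \<open>r\<close> vertices is untouched with probability at least one half, and these
  events are independent for edge-disjoint sets.\<close>

lemma random_recolouring:
  fixes H :: "nat \<Rightarrow> nat \<Rightarrow> bool"
  assumes N: "N \<le> 2 ^ r" and r: "2 \<le> r" and m: "1 \<le> m" and H: "ramsey_at {..<N} H m r"
  shows "\<exists>E. symp E \<and> ramsey_at {..<N} E (2 * m * (2 * r\<^sup>2 * (r + 3) + 1)) r
    \<and> ramsey_at {..<N} E (8 * r\<^sup>2 * (r + 3) + 1) 2"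
proof -
  define s where "s = 2 * m * (2 * r\<^sup>2 * (r + 3) + 1)"
  \<comment> \<open>This is \<open>2 * D * (r + 3) + 1\<close>, so that \<open>x\<close> vertices
    span exactly \<open>D * (x * (r + 3))\<close> pairs.\<close>
  define x where "x = 8 * r\<^sup>2 * (r + 3) + 1"
  define D where "D = 4 * r\<^sup>2"
  define I where "I = pairs {..<N}"
  define \<Omega> where "\<Omega> = I \<rightarrow>\<^sub>E {..<D}"
  \<comment> \<open>The bad events. Value 0 forces an edge, 1 a non-edge, and others keep
    \<open>H\<close>. In \<open>B1\<close> every suitable \<open>r\<close>-set in \<open>S\<close>
    is touched; in \<open>B2\<close> no pair of \<open>S\<close> is forced to colour
    \<open>c\<close>.\<close>
  define B1 where "B1 S c = {\<xi> \<in> \<Omega>. \<forall>C\<subseteq>S. card C = r \<and> monochromatic c H C \<longrightarrow> (\<exists>i\<in>pairs C. \<xi> i < 2)}"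
    for S c
  define B2 where "B2 S c = {\<xi> \<in> \<Omega>. \<forall>i\<in>pairs S. \<xi> i \<noteq> (if c then 0 else 1)}" for S c
  have finI: "finite I" by (simp add: I_def finite_pairs)
  have card\<Omega>: "card \<Omega> = D ^ card I" using finI by (simp add: \<Omega>_def card_PiE)
  have fin\<Omega>: "finite \<Omega>" using finI by (auto simp: \<Omega>_def intro: finite_PiE)
  have "1 * 1 \<le> r * r" using r by (intro mult_le_mono) auto
  then have D2: "2 \<le> D" by (simp add: D_def power2_eq_square)
  have b1: "card (B1 S c) * 2 ^ (s * r + 3) \<le> card \<Omega>" if S: "S \<subseteq> {..<N}" "card S = s" for S c
  proof -
    have finS: "finite S" using S(1) finite_subset by blast
    \<comment> \<open>The source of \<open>r + 3\<close>: \<open>s * r\<close> halvings offset the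
      number of sets \<open>S\<close>, three more give the margin of the union bound, and
      \<open>s * (r + 3)\<close> covers both.\<close>
    have "1 \<le> s" using m by (simp add: s_def)
    then have "s * r + 3 \<le> card S * (r + 3)" using S(2) by (simp add: algebra_simps)
    moreover have "2 * m * (2 * r\<^sup>2 * (r + 3) + 1) \<le> card S" using S(2) by (simp add: s_def)
    moreover have "\<exists>C\<subseteq>T. card C = r \<and> monochromatic c H C" if "T \<subseteq> S" "m \<le> card T" for T
      using H S(1) that unfolding ramsey_at_def by blast
    ultimately obtain F where F: "finite F" "card F = s * r + 3"
      "\<forall>C\<in>F. C \<subseteq> S \<and> card C = r \<and> monochromatic c H C"
      "\<forall>C\<in>F. \<forall>D\<in>F. C \<noteq> D \<longrightarrow> pairs C \<inter> pairs D = {}"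
      using edge_disjoint_family[OF finS r, of m "monochromatic c H" "s * r + 3"] by blast
    have "card {\<xi> \<in> I \<rightarrow>\<^sub>E {..<4 * r\<^sup>2}. \<forall>C\<in>F. \<exists>i\<in>pairs C. \<xi> i < 2} * 2 ^ card F \<le> (4 * r\<^sup>2) ^ card I"
    proof (rule card_functions_hitting[OF finI F(1)])
      show "1 \<le> r\<^sup>2" using r by (simp add: power2_eq_square)
      show "pairs C \<subseteq> I \<and> card (pairs C) \<le> r\<^sup>2" if "C \<in> F" for C
      proof -
        have "C \<subseteq> S" "card C = r" using F(3) that by auto
        then show ?thesis
          using S(1) finS card_pairs_le[of C] pairs_mono[of C "{..<N}"] by (auto simp: I_def intro: finite_subset)
      qed
    qed (use F(4) in blast)
    moreover have "card (B1 S c) \<le> card {\<xi> \<in> I \<rightarrow>\<^sub>E {..<4 * r\<^sup>2}. \<forall>C\<in>F. \<exists>i\<in>pairs C. \<xi> i < 2}"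
      using fin\<Omega> F(3) by (intro card_mono) (auto simp: B1_def \<Omega>_def D_def)
    ultimately show ?thesis
      unfolding card\<Omega> D_def F(2) by (meson mult_le_mono1 order_trans)
  qed
  have b2: "card (B2 X c) * 2 ^ (x * r + 3) \<le> card \<Omega>" if X: "X \<subseteq> {..<N}" "card X = x" for X c
  proof -
    have "finite X" using X(1) finite_subset by blast
    then have "2 * card (pairs X) + x = x * x" using card_pairs[of X] X(2) by (simp add: power2_eq_square)
    moreover have "x * x = x * (2 * D * (r + 3)) + x" by (simp add: x_def D_def algebra_simps)
    ultimately have "card (pairs X) = D * (x * (r + 3))" by simp
    moreover have "x * r + 3 \<le> x * (r + 3)" by (simp add: x_def algebra_simps)
    ultimately have "D * (x * r + 3) \<le> card (pairs X)" by simp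
    moreover have "pairs X \<subseteq> I" using X(1) by (simp add: I_def pairs_mono)
    ultimately show ?thesis
      unfolding B2_def card\<Omega> unfolding \<Omega>_def
      using D2 by (intro card_functions_avoiding finI) auto
  qed
  let ?U1 = "\<Union>S\<in>{S. S \<subseteq> {..<N} \<and> card S = s}. \<Union>c. B1 S c"
  let ?U2 = "\<Union>S\<in>{S. S \<subseteq> {..<N} \<and> card S = x}. \<Union>c. B2 S c"
  have "4 * card ?U1 \<le> card \<Omega>" "4 * card ?U2 \<le> card \<Omega>"
    using card_union_over_subsets[OF N] b1 b2 by blast+
  moreover have "card (?U1 \<union> ?U2) \<le> card ?U1 + card ?U2" by (rule card_Un_le)
  moreover have "0 < card \<Omega>" using card\<Omega> D2 by simp
  ultimately have "card (?U1 \<union> ?U2) < card \<Omega>" by linarith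
  then have "\<not> \<Omega> \<subseteq> ?U1 \<union> ?U2"
    using fin\<Omega> card_mono[of "?U1 \<union> ?U2" \<Omega>] finite_subset[of "?U1 \<union> ?U2" \<Omega>]
    by (auto simp: B1_def B2_def)
  then obtain \<xi> where \<xi>: "\<xi> \<in> \<Omega>" "\<xi> \<notin> ?U1" "\<xi> \<notin> ?U2" by blast
  \<comment> \<open>\<open>H\<close> need not be symmetric. The conjunction makes \<open>E\<close>
    symmetric and keeps the colour on monochromatic sets, where both orientations agree.\<close>
  define E where "E u v = (let p = (min u v, max u v) in
      if \<xi> p = 0 then True else if \<xi> p = 1 then False else H u v \<and> H v u)" for u v
  have "symp E" by (auto simp: E_def Let_def min.commute max.commute intro!: sympI)
  moreover have "ramsey_at {..<N} E s r"
    unfolding ramsey_at_def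
  proof (intro allI impI)
    fix S c assume S: "S \<subseteq> {..<N}" "s \<le> card S"
    then obtain T where T: "T \<subseteq> S" "card T = s" by (metis obtain_subset_with_card_n)
    then have "\<xi> \<notin> B1 T c" using \<xi>(2) S(1) by blast
    then obtain C where C: "C \<subseteq> T" "card C = r" "monochromatic c H C" "\<forall>i\<in>pairs C. \<not> \<xi> i < 2"
      using \<xi>(1) by (auto simp: B1_def)
    have "monochromatic c E C" unfolding monochromatic_def
    proof (intro ballI impI)
      fix u v assume uv: "u \<in> C" "v \<in> C" "u \<noteq> v"
      then have "(min u v, max u v) \<in> pairs C" by (auto simp: pairs_def min_def max_def)
      then have "\<not> \<xi> (min u v, max u v) < 2" using C(4) by blast
      moreover have "H u v = c" "H v u = c" using C(3) uv by (auto simp: monochromatic_def)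
      ultimately show "E u v = c" by (auto simp: E_def Let_def)
    qed
    with C(1,2) T(1) show "\<exists>C\<subseteq>S. card C = r \<and> monochromatic c E C" by blast
  qed
  moreover have "ramsey_at {..<N} E x 2"
    unfolding ramsey_at_def
  proof (intro allI impI)
    fix S c assume S: "S \<subseteq> {..<N}" "x \<le> card S"
    then obtain T where T: "T \<subseteq> S" "card T = x" by (metis obtain_subset_with_card_n)
    then have "\<xi> \<notin> B2 T c" using \<xi>(3) S(1) by blast
    then obtain u v where uv: "u \<in> T" "v \<in> T" "u < v" "\<xi> (u, v) = (if c then 0 else 1)"
      using \<xi>(1) by (auto simp: B2_def pairs_def)
    then have "E u v = c" by (auto simp: E_def Let_def)
    moreover have "E v u = c" using calculation \<open>symp E\<close> by (metis sympD)
    ultimately have "monochromatic c E {u, v}" by (auto simp: monochromatic_def)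
    moreover have "card {u, v} = 2" using uv(3) by simp
    ultimately show "\<exists>C\<subseteq>S. card C = 2 \<and> monochromatic c E C" using uv T(1)
      by (intro exI[of _ "{u, v}"]) auto
  qed
  ultimately show ?thesis unfolding s_def x_def by blast
qed

section \<open>Iteration\<close>

text \<open>The invariant of the iteration. Its second threshold depends on \<open>r\<close> alone,
  so it does not deteriorate from round to round.\<close>

definition robust_ramsey :: "nat \<Rightarrow> nat \<Rightarrow> nat \<Rightarrow> bool" where
  "robust_ramsey r N m \<longleftrightarrow> (\<exists>E :: nat \<Rightarrow> nat \<Rightarrow> bool. symp E \<and> ramsey_at {..<N} E m r
     \<and> ramsey_at {..<N} E (8 * r\<^sup>2 * (r + 3) + 1) 2)"

lemma robust_ramsey_mono: "robust_ramsey r N m \<Longrightarrow> m \<le> m' \<Longrightarrow> robust_ramsey r N m'"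
  unfolding robust_ramsey_def by (meson order_refl ramsey_at_mono)

text \<open>Start of the iteration: recolouring an arbitrary relation, here the full one, yields the
  second property, while no vertex set reaches size \<open>m\<close>.\<close>

lemma robust_ramsey_vacuous:
  assumes "2 \<le> r" "N \<le> 2 ^ r" "N < m"
  shows "robust_ramsey r N m"
proof -
  have "ramsey_at {..<N} (\<lambda>_ _. True) (N + 1) r" by (rule ramsey_at_vacuous) auto
  with random_recolouring[OF assms(2,1), of "N + 1"] obtain E where
    "symp E" "ramsey_at {..<N} E (8 * r\<^sup>2 * (r + 3) + 1) 2" by auto
  moreover have "ramsey_at {..<N} E m r" using assms(3) by (intro ramsey_at_vacuous) auto
  ultimately show ?thesis unfolding robust_ramsey_def by blast
qed

text \<open>One round: take the power, embed \<open>N\<close> vertices into it, and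
  recolour.\<close>

lemma robust_ramsey_lex:
  assumes "robust_ramsey r n m" "2 \<le> r" "r \<le> 2 ^ l" "1 \<le> m" "N \<le> n ^ k" "N \<le> 2 ^ r"
  shows "robust_ramsey r N (2 * ((2 * (8 * r\<^sup>2 * (r + 3) + 1)) ^ k * (2 * m) ^ l) * (2 * r\<^sup>2 * (r + 3) + 1))"
proof -
  obtain E :: "nat \<Rightarrow> nat \<Rightarrow> bool" where E: "symp E" "ramsey_at {..<n} E m r"
    "ramsey_at {..<n} E (8 * r\<^sup>2 * (r + 3) + 1) 2"
    using assms(1) unfolding robust_ramsey_def by blast
  define m' where "m' = (2 * (8 * r\<^sup>2 * (r + 3) + 1)) ^ k * (2 * m) ^ l"
  let ?L = "{xs. set xs \<subseteq> {..<n} \<and> length xs = k}"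
  have L: "ramsey_at ?L (lexE E) m' r"
    unfolding m'_def using E assms(3,4) by (intro ramsey_at_lexE) auto
  have "finite ?L" "card {..<N} \<le> card ?L"
    using assms(5) by (auto simp: finite_lists_length_eq card_lists_length_eq)
  from card_le_inj[OF finite_lessThan this]
  obtain f where f: "f ` {..<N} \<subseteq> ?L" "inj_on f {..<N}" by blast
  have H: "ramsey_at {..<N} (\<lambda>u v. lexE E (f u) (f v)) m' r"
    by (rule ramsey_at_pullback[OF L f(2,1)])
  have "1 * 1 \<le> m'" unfolding m'_def using assms(4) by (intro mult_le_mono one_le_power) auto
  then have "1 \<le> m'" by simp
  from random_recolouring[OF assms(6,2) this H] show ?thesis
    unfolding robust_ramsey_def m'_def .
qed

text \<open>The exponent \<open>k = M\<close> balances the two factors of the threshold: both then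
  contribute O(\<open>l * M\<close>) to its logarithm. The 20 absorbs all constants.\<close>

lemma robust_ramsey_step:
  assumes "robust_ramsey r (2 ^ a) (2 ^ M)" "2 \<le> r" "r \<le> 2 ^ l" "1 \<le> l" "1 \<le> M"
    "b \<le> a * M" "b \<le> r"
  shows "robust_ramsey r (2 ^ b) (2 ^ (20 * l * M))"
proof -
  have "(2::nat) ^ b \<le> (2 ^ a) ^ M" "(2::nat) ^ b \<le> 2 ^ r"
    using assms(6,7) by (simp_all flip: power_mult)
  note R = robust_ramsey_lex[OF assms(1-3) _ this]
  have r3: "r ^ 3 \<le> 2 ^ (3 * l)" using power_mono[OF assms(3), of 3] by (simp add: power_mult mult.commute flip: power_mult)
  have "r\<^sup>2 * 1 \<le> r\<^sup>2 * r" "1 * 1 * 1 \<le> r * r * r" using assms(2) by (intro mult_le_mono; simp)+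
  then have le: "r\<^sup>2 \<le> r ^ 3" "1 \<le> r ^ 3" by (simp_all add: power2_eq_square power3_eq_cube)
  have sq: "r\<^sup>2 * (r + 3) = r ^ 3 + 3 * r\<^sup>2" by (simp add: power2_eq_square power3_eq_cube algebra_simps)
  have "2 * (8 * r\<^sup>2 * (r + 3) + 1) \<le> 128 * r ^ 3" using le sq by simp
  also have "\<dots> \<le> 2 ^ (7 + 3 * l)" using r3 by (simp add: power_add)
  finally have x: "2 * (8 * r\<^sup>2 * (r + 3) + 1) \<le> 2 ^ (7 + 3 * l)" .
  have "2 * r\<^sup>2 * (r + 3) + 1 \<le> 16 * r ^ 3" using le sq by simp
  also have "\<dots> \<le> 2 ^ (4 + 3 * l)" using r3 by (simp add: power_add)
  finally have y: "2 * r\<^sup>2 * (r + 3) + 1 \<le> 2 ^ (4 + 3 * l)" .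
  have "2 * ((2 * (8 * r\<^sup>2 * (r + 3) + 1)) ^ M * (2 * 2 ^ M) ^ l) * (2 * r\<^sup>2 * (r + 3) + 1)
      \<le> 2 * ((2 ^ (7 + 3 * l)) ^ M * (2 ^ (M + 1)) ^ l) * 2 ^ (4 + 3 * l)"
    using x y by (intro mult_le_mono power_mono) auto
  also have "\<dots> = 2 ^ (1 + ((7 + 3 * l) * M + (M + 1) * l) + (4 + 3 * l))"
    unfolding power_mult[symmetric] unfolding power_add[symmetric] power_Suc[symmetric] by simp
  also have "\<dots> \<le> 2 ^ (20 * l * M)"
  proof (rule power_increasing)
    have "M \<le> l * M" "l \<le> l * M" using assms(4,5) by simp_all
    then have "5 + 7 * M + 4 * l \<le> 16 * (l * M)" using assms(4) by linarith
    then show "1 + ((7 + 3 * l) * M + (M + 1) * l) + (4 + 3 * l) \<le> 20 * l * M"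
      by (simp add: algebra_simps)
  qed simp
  finally show ?thesis using R robust_ramsey_mono by simp
qed

text \<open>Each round multiplies the exponent of the vertex count by at least \<open>A\<close>,
  until the cap \<open>r\<close> that recolouring imposes. Initially the threshold exceeds the
  number of vertices.\<close>

lemma robust_ramsey_iterate:
  assumes "2 \<le> r" "r \<le> 2 ^ l" "1 \<le> l"
  shows "robust_ramsey r (2 ^ min r (A ^ (i + 1))) (2 ^ ((20 * l) ^ i * (A + 1)))"
proof (induction i)
  case 0
  have "(2::nat) ^ min r A < 2 ^ (A + 1)" by (rule power_strict_increasing) auto
  then show ?case using assms(1) by (intro robust_ramsey_vacuous) auto
next
  case (Suc i)
  define M where "M = (20 * l) ^ i * (A + 1)"
  have "1 * (A + 1) \<le> M" unfolding M_def using assms(3) by (intro mult_le_mono) auto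
  then have M: "1 \<le> M" "A \<le> M" by auto
  have "min r (A ^ (Suc i + 1)) \<le> min r (A ^ (i + 1)) * M"
  proof (cases "r \<le> A ^ (i + 1)")
    case True
    have "min r (A ^ (Suc i + 1)) \<le> r * 1" by simp
    also have "\<dots> \<le> r * M" using M(1) by (rule mult_le_mono2)
    finally show ?thesis using True by simp
  next
    case False
    have "min r (A ^ (Suc i + 1)) \<le> A ^ (i + 1) * A" by (simp add: mult_ac)
    also have "\<dots> \<le> A ^ (i + 1) * M" using M(2) by (rule mult_le_mono2)
    finally show ?thesis using False by simp
  qed
  from robust_ramsey_step[OF _ assms M(1) this] Suc.IH
  show ?case by (simp add: M_def mult_ac)
qed

text \<open>Starting from \<open>A = 2 ^ w\<close>, \<open>w - 1\<close> rounds give the exponent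
  \<open>2 ^ (w * w)\<close>, which is at least \<open>r\<close>. Taking \<open>w\<close> near the
  square root of \<open>l\<close> keeps both \<open>2 ^ w\<close> and \<open>(20 * l) ^ w\<close>
  small.\<close>

lemma robust_ramsey_exists:
  assumes "2 \<le> r" "r \<le> 2 ^ l" "1 \<le> l" "l \<le> w * w" "1 \<le> w"
  shows "robust_ramsey r (2 ^ r) (2 ^ ((20 * l) ^ w * 2 ^ (w + 1)))"
proof -
  obtain i where i: "w = Suc i" using assms(5) by (cases w) auto
  have "r \<le> 2 ^ (w * w)" using assms(2,4) by (meson order_trans one_le_numeral power_increasing)
  then have "r \<le> (2 ^ w) ^ (i + 1)" unfolding power_mult[symmetric] by (simp add: i)
  then have "min r ((2 ^ w) ^ (i + 1)) = r" by simp
  then have R: "robust_ramsey r (2 ^ r) (2 ^ ((20 * l) ^ i * (2 ^ w + 1)))"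
    using robust_ramsey_iterate[OF assms(1-3), of "2 ^ w" i] by simp
  have "(20 * l) ^ i * (2 ^ w + 1) \<le> (20 * l) ^ w * 2 ^ (w + 1)"
    using assms(3) i by (intro mult_le_mono power_increasing) auto
  then have "(2::nat) ^ ((20 * l) ^ i * (2 ^ w + 1)) \<le> 2 ^ ((20 * l) ^ w * 2 ^ (w + 1))"
    by (rule power_increasing) simp
  with R show ?thesis by (rule robust_ramsey_mono)
qed

section \<open>The bound on the threshold\<close>

lemma mG_le:
  assumes "locally_ramsey V E (real m) r"
  shows "mG V E r \<le> m"
  unfolding mG_def using assms by (rule Least_le)

text \<open>Restricting to \<open>n\<close> vertices and deleting loops changes no pair of distinct
  remaining vertices.\<close>

lemma robust_ramsey_graph:
  assumes "robust_ramsey r N m" "n \<le> N" "\<rho> \<le> real r"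
  shows "\<exists>E. simple_graph {0..<n} E \<and> mG {0..<n} E \<rho> \<le> m"
proof -
  obtain E where E: "symp E" "ramsey_at {..<N} E m r"
    using assms(1) unfolding robust_ramsey_def by blast
  define G where "G u v \<longleftrightarrow> u < n \<and> v < n \<and> u \<noteq> v \<and> E u v" for u v
  have "simple_graph {0..<n} G"
    using E(1) by (auto simp: simple_graph_def G_def dest: sympD)
  moreover have "locally_ramsey {0..<n} G (real m) \<rho>"
    unfolding locally_ramsey_def
  proof (intro allI impI)
    fix S assume S: "S \<subseteq> {0..<n} \<and> real m \<le> real (card S)"
    then have SN: "S \<subseteq> {..<N}" "m \<le> card S" using assms(2) by auto
    obtain C where C: "C \<subseteq> S" "card C = r" "monochromatic True E C"
      using ramsey_atD[OF E(2) SN] .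
    obtain D where D: "D \<subseteq> S" "card D = r" "monochromatic False E D"
      using ramsey_atD[OF E(2) SN] .
    have lt: "u < n" if "u \<in> S" for u using S that by auto
    have "is_clique G C"
      unfolding is_clique_def G_def using C(1,3) lt unfolding monochromatic_def by blast
    moreover have "is_indep G D"
      unfolding is_indep_def G_def using D(3) unfolding monochromatic_def by blast
    moreover have "\<rho> \<le> real (card C)" "\<rho> \<le> real (card D)"
      using C(2) D(2) assms(3) by simp_all
    ultimately show "(\<exists>C\<subseteq>S. is_clique G C \<and> \<rho> \<le> real (card C)) \<and> (\<exists>I\<subseteq>S. is_indep G I \<and> \<rho> \<le> real (card I))"
      using C(1) D(1) by blast
  qed
  ultimately show ?thesis using mG_le by blast
qed

text \<open>Here \<open>z\<close> stands for \<open>log log n\<close>.\<close>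

definition exponent_bound :: "real \<Rightarrow> real" where
  "exponent_bound z = (sqrt (z + 2) + 1) * (log 2 (20 * (z + 2)) + 1) + 1"

lemma exponent_bound_pos: "0 < z \<Longrightarrow> 0 < exponent_bound z"
  unfolding exponent_bound_def by (intro add_nonneg_pos mult_nonneg_nonneg) (auto intro!: add_nonneg_nonneg)

lemma graph_exists:
  assumes "3 \<le> n"
  shows "\<exists>E. simple_graph {0..<n} E \<and> real (mG {0..<n} E (log 2 (real n)))
     \<le> 2 powr (2 powr exponent_bound (log 2 (log 2 (real n))))"
proof -
  define z where "z = log 2 (log 2 (real n))"
  define r where "r = nat \<lceil>log 2 (real n)\<rceil>"
  define l where "l = nat \<lceil>log 2 (real r)\<rceil>"
  define w where "w = nat \<lceil>sqrt (real l)\<rceil>"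
  have n1: "1 < log 2 (real n)" using assms by (simp add: less_log_iff)
  then have r: "2 \<le> r" "log 2 (real n) \<le> real r" "real r \<le> log 2 (real n) + 1"
    unfolding r_def by linarith+
  have "1 \<le> log 2 (real r)" using r(1) by (simp add: le_log_iff)
  then have l: "1 \<le> l" "log 2 (real r) \<le> real l" "real l \<le> log 2 (real r) + 1"
    unfolding l_def by linarith+
  have "1 \<le> sqrt (real l)" using l(1) by simp
  then have w: "1 \<le> w" "sqrt (real l) \<le> real w" "real w \<le> sqrt (real l) + 1"
    unfolding w_def by linarith+
  have "real n \<le> 2 ^ r" using r(2) assms by (simp add: log_le_iff powr_realpow)
  then have nr: "n \<le> 2 ^ r" by (metis of_nat_le_iff of_nat_numeral of_nat_power)
  have "real r \<le> 2 ^ l" using l(2) r(1) by (simp add: log_le_iff powr_realpow)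
  then have rl: "r \<le> 2 ^ l" by (metis of_nat_le_iff of_nat_numeral of_nat_power)
  have "real l = sqrt (real l) * sqrt (real l)" by simp
  also have "\<dots> \<le> real w * real w" using w(2) by (intro mult_mono) auto
  finally have lw: "l \<le> w * w" by (metis of_nat_le_iff of_nat_mult)
  define M where "M = (20 * l) ^ w * 2 ^ (w + 1)"
  obtain E where E: "simple_graph {0..<n} E" "mG {0..<n} E (log 2 (real n)) \<le> 2 ^ M"
    using robust_ramsey_graph[OF robust_ramsey_exists[OF r(1) rl l(1) lw w(1)] nr r(2)]
    unfolding M_def by blast
  \<comment> \<open>The 2 in \<open>z + 2\<close> pays for two roundings: \<open>r\<close> is at
    most twice log n, and \<open>l\<close> exceeds log r by at most 1.\<close>
  have "log 2 (real r) \<le> log 2 (2 * log 2 (real n))" using r n1 by simp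
  also have "\<dots> = 1 + z" using n1 by (simp add: z_def log_mult)
  finally have lz: "real l \<le> z + 2" using l(3) by simp
  have "log 2 (real M) = real w * log 2 (20 * real l) + (real w + 1)"
    using l(1) by (simp add: M_def log_mult log_nat_power algebra_simps)
  also have "\<dots> = real w * (log 2 (20 * real l) + 1) + 1" by (simp add: algebra_simps)
  also have "\<dots> \<le> (sqrt (z + 2) + 1) * (log 2 (20 * (z + 2)) + 1) + 1"
  proof -
    have "real w \<le> sqrt (z + 2) + 1" using w(3) real_sqrt_le_mono[OF lz] by linarith
    moreover have "log 2 (20 * real l) \<le> log 2 (20 * (z + 2))" using lz l(1) by simp
    moreover have "0 \<le> log 2 (20 * real l)" using l(1) by simp
    ultimately show ?thesis by (intro add_mono mult_mono) auto
  qed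
  finally have "log 2 (real M) \<le> exponent_bound z" by (simp add: exponent_bound_def)
  moreover have "0 < real M" using l(1) by (simp add: M_def)
  ultimately have "real M \<le> 2 powr exponent_bound z" by (simp add: log_le_iff)
  then have "2 powr real M \<le> 2 powr (2 powr exponent_bound z)" by simp
  moreover have "real (mG {0..<n} E (log 2 (real n))) \<le> 2 powr real M"
    using E(2) by (simp add: powr_realpow)
  ultimately have "real (mG {0..<n} E (log 2 (real n))) \<le> 2 powr (2 powr exponent_bound z)"
    by linarith
  with E(1) show ?thesis unfolding z_def by blast
qed

section \<open>Asymptotics of the exponent, and the small cases\<close>

text \<open>\<open>exponent_bound z\<close> is \<open>sqrt z\<close> up to a factor of order log z,
  whose logarithm is negligible against \<open>ln z\<close>.\<close>

lemma exponent_tendsto: "((\<lambda>z. ln (exponent_bound z) / ln z - 1 / 2) \<longlongrightarrow> 0) at_top"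
  unfolding exponent_bound_def by real_asymp

theorem theorem1p1:
  shows "\<exists>\<epsilon> :: nat \<Rightarrow> real. \<epsilon> \<longlonglongrightarrow> 0 \<and>
    (\<forall>n::nat. n \<ge> 1 \<longrightarrow> (\<exists>E :: nat \<Rightarrow> nat \<Rightarrow> bool. simple_graph {0..<n} E \<and>
       real (mG {0..<n} E (log 2 (real n)))
         \<le> 2 powr (2 powr ((log 2 (log 2 (real n))) powr (1/2 + \<epsilon> n)))))"
proof -
  define z where "z n = log 2 (log 2 (real n))" for n :: nat
  \<comment> \<open>Solves \<open>z n powr (1/2 + \<epsilon> n) = exponent_bound (z n)\<close>
    whenever \<open>z n\<close> is positive and different from 1.\<close>
  define \<epsilon> where "\<epsilon> n = ln (exponent_bound (z n)) / ln (z n) - 1 / 2" for n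
  have "filterlim z at_top sequentially" unfolding z_def by real_asymp
  then have "\<epsilon> \<longlonglongrightarrow> 0"
    unfolding \<epsilon>_def by (rule filterlim_compose[OF exponent_tendsto])
  moreover have "\<exists>E :: nat \<Rightarrow> nat \<Rightarrow> bool. simple_graph {0..<n} E \<and>
      real (mG {0..<n} E (log 2 (real n))) \<le> 2 powr (2 powr (z n powr (1/2 + \<epsilon> n)))"
    if n: "n \<ge> 1" for n
  proof -
    \<comment> \<open>For \<open>n = 2\<close> and \<open>n = 4\<close> the base \<open>log log n\<close> is 0 or 1, so that \<open>\<epsilon>\<close> has no effect; for \<open>n = 1\<close> it is 0
      only because the logarithm of 0 is 0 by convention.\<close>
    consider "n = 1" | "n = 2" | "n = 4" | "n \<ge> 3" "n \<noteq> 4" using n by linarith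
    then show ?thesis
    proof cases
      case 1
      have "locally_ramsey {0..<n} (\<lambda>_ _. False) (real 0) (log 2 (real n))"
        using 1 by (auto simp: locally_ramsey_def is_clique_def is_indep_def)
      then have "mG {0..<n} (\<lambda>_ _. False) (log 2 (real n)) \<le> 0" by (rule mG_le)
      then show ?thesis
        by (intro exI[of _ "\<lambda>_ _. False"]) (simp add: simple_graph_def)
    next
      case 2
      \<comment> \<open>A single vertex is both a clique and an independent set. As
        \<open>0 powr a = 0\<close>, the bound to meet is 2.\<close>
      have "locally_ramsey {0..<n} (\<lambda>_ _. False) (real 1) (log 2 (real n))"
        unfolding locally_ramsey_def
      proof (intro allI impI)
        fix S assume "S \<subseteq> {0..<n} \<and> real 1 \<le> real (card S)"
        then obtain v where "v \<in> S" by fastforce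
        then show "(\<exists>C\<subseteq>S. is_clique (\<lambda>_ _. False) C \<and> log 2 (real n) \<le> real (card C)) \<and>
            (\<exists>I\<subseteq>S. is_indep (\<lambda>_ _. False) I \<and> log 2 (real n) \<le> real (card I))"
          using 2 by (intro conjI exI[of _ "{v}"]) (auto simp: is_clique_def is_indep_def)
      qed
      then have "mG {0..<n} (\<lambda>_ _. False) (log 2 (real n)) \<le> 1" by (rule mG_le)
      moreover have "z n = 0" using 2 by (simp add: z_def)
      ultimately show ?thesis
        by (intro exI[of _ "\<lambda>_ _. False"]) (simp add: simple_graph_def)
    next
      case 3
      have log4: "log 2 (real n) = 2"
        using 3 log_powr_cancel[of 2 2] by (simp add: powr_numeral)
      \<comment> \<open>Here the bound is exactly 4, so only the whole vertex set has to be served;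
        a graph with the single edge 01 does so.\<close>
      define E where "E u v \<longleftrightarrow> u + v = (1::nat)" for u v
      have "locally_ramsey {0..<n} E (real 4) (log 2 (real n))"
        unfolding locally_ramsey_def
      proof (intro allI impI)
        fix S assume S: "S \<subseteq> {0..<n} \<and> real 4 \<le> real (card S)"
        then have "S = {0..<n}" using 3 by (intro card_seteq) auto
        then have "{0, 1} \<subseteq> S" "{0, 2} \<subseteq> S" using 3 by auto
        moreover have "is_clique E {0, 1}" "is_indep E {0, 2}"
          by (auto simp: is_clique_def is_indep_def E_def)
        moreover have "log 2 (real n) \<le> real (card {0, 1::nat})" "log 2 (real n) \<le> real (card {0, 2::nat})"
          by (simp_all add: log4)
        ultimately show "(\<exists>C\<subseteq>S. is_clique E C \<and> log 2 (real n) \<le> real (card C)) \<and>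
            (\<exists>I\<subseteq>S. is_indep E I \<and> log 2 (real n) \<le> real (card I))"
          by blast
      qed
      then have "mG {0..<n} E (log 2 (real n)) \<le> 4" by (rule mG_le)
      moreover have "simple_graph {0..<n} E" using 3 by (auto simp: simple_graph_def E_def) presburger
      moreover have "z n = 1" by (simp add: z_def log4)
      ultimately show ?thesis by (intro exI[of _ E]) (simp add: powr_numeral)
    next
      case 4
      have "1 < log 2 (real n)" using 4 by (simp add: less_log_iff)
      then have z0: "0 < z n" by (simp add: z_def)
      \<comment> \<open>Excludes \<open>z n = 1\<close>, where the division by
        \<open>ln (z n)\<close> would fail.\<close>
      have "log 2 (real n) \<noteq> 2"
      proof
        assume "log 2 (real n) = 2"
        then have "real n = 4" using powr_log_cancel[of 2 "real n"] 4 by simp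
        with 4 show False by simp
      qed
      then have "z n \<noteq> 1"
        using \<open>1 < log 2 (real n)\<close> powr_log_cancel[of 2 "log 2 (real n)"] unfolding z_def by force
      then have "z n powr (1/2 + \<epsilon> n) = exponent_bound (z n)"
        using z0 exponent_bound_pos[OF z0] by (simp add: \<epsilon>_def powr_def)
      with graph_exists[OF 4(1)] show ?thesis by (simp add: z_def)
    qed
  qed
  ultimately show ?thesis unfolding z_def by blast
qed

end
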